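(* Let $A\subset\mathbb{R}^n$, let $x\in\overline A$, and let $d\in[0,n]$. Assume that \begin{enumerate} \item $A$ has lower spatial $d$-ubiquity at $x$; \item $A$ has pointwise upper-box covering control of exponent $d$ at $x$. \end{enumerate} Then \[ \dim_{\mathrm{Pbox}}\{x\}_A=d. \]
   Context: For bounded $E\subset\mathbb{R}^n$, $N_\varepsilon(E)$ is the minimal number of sets of diameter at most $\varepsilon$ covering $E$ and $\overline{\dim}_B(E):=\limsup_{\varepsilon\to0}\frac{\ln N_\varepsilon(E)}{\ln(1/\varepsilon)}$. For $x\in\overline A$, $\dim_{\mathrm{Pbox}}\{x\}_A:=\inf_{r>0}\overline{\dim}_B(A\cap B(x,r))$. A set is $\varepsilon$-separated if any two of its distinct points are at distance at least $\varepsilon$. Lower spatial $d$-ubiquity at $x$: for every $\rho_0>0$, every $0<\rho<\rho_0$, and every $\eta>0$, there exist scales $\varepsilon_m\downarrow0$, $0<\varepsilon_m<\rho$, and finite sets $F_m\subset A\cap B(x,\rho)$ such that $F_m$ is $\varepsilon_m$-separated and $\#F_m\ge(\rho/\varepsilon_m)^{d-\eta}$ for all $m$ large enough. Pointwise upper-box covering control of exponent $d$ at $x$: for every sufficiently small $R>0$ and every $\eta>0$, there exist constants $C_{R,\eta}>0$ and $\varepsilon_{R,\eta}>0$ such that, for every $0<\varepsilon<\varepsilon_{R,\eta}$, $N_\varepsilon(A\cap B(x,R))\le C_{R,\eta}(R/\varepsilon)^{d+\eta}$. *)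

theory Defs
  imports "HOL-Analysis.Analysis"
begin

text \<open>
  The covering sets are required to be bounded because \<^const>\<open>diameter\<close> is a real number and
  carries no information for unbounded sets. The definition is meant for bounded \<open>E\<close> and
  \<open>\<epsilon> > 0\<close>; in Euclidean space a finite cover then exists.
\<close>

definition covering_number :: "real \<Rightarrow> 'a::metric_space set \<Rightarrow> nat" where
  "covering_number \<epsilon> E =
     (LEAST k. \<exists>\<U>. finite \<U> \<and> card \<U> = k \<and>
        (\<forall>U\<in>\<U>. bounded U \<and> diameter U \<le> \<epsilon>) \<and> E \<subseteq> \<Union>\<U>)"

definition upper_box_dim :: "'a::metric_space set \<Rightarrow> ereal" where
  "upper_box_dim E =
     Limsup (at_right 0) (\<lambda>\<epsilon>. ereal (ln (real (covering_number \<epsilon> E)) / ln (1 / \<epsilon>)))"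

text \<open>Intended for \<open>x \<in> closure A\<close>, so that no \<open>A \<inter> ball x r\<close> is empty.\<close>

definition pointwise_box_dim :: "'a::metric_space \<Rightarrow> 'a set \<Rightarrow> ereal" where
  "pointwise_box_dim x A = (INF r\<in>{0<..}. upper_box_dim (A \<inter> ball x r))"

definition separated_by :: "real \<Rightarrow> 'a::metric_space set \<Rightarrow> bool" where
  "separated_by \<epsilon> F \<longleftrightarrow> (\<forall>a\<in>F. \<forall>b\<in>F. a \<noteq> b \<longrightarrow> \<epsilon> \<le> dist a b)"

definition lower_spatial_ubiquity :: "real \<Rightarrow> 'a::metric_space \<Rightarrow> 'a set \<Rightarrow> bool" where
  "lower_spatial_ubiquity d x A \<longleftrightarrow>
     (\<forall>\<rho>\<^sub>0>0. \<forall>\<rho>. 0 < \<rho> \<and> \<rho> < \<rho>\<^sub>0 \<longrightarrow> (\<forall>\<eta>>0.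
        \<exists>(\<epsilon> :: nat \<Rightarrow> real) (F :: nat \<Rightarrow> 'a set).
          decseq \<epsilon> \<and> \<epsilon> \<longlonglongrightarrow> 0 \<and>
          (\<forall>m. 0 < \<epsilon> m \<and> \<epsilon> m < \<rho>) \<and>
          (\<forall>m. finite (F m) \<and> F m \<subseteq> A \<inter> ball x \<rho> \<and> separated_by (\<epsilon> m) (F m)) \<and>
          (\<forall>\<^sub>F m in sequentially. (\<rho> / \<epsilon> m) powr (d - \<eta>) \<le> real (card (F m)))))"

definition upper_box_covering_control :: "real \<Rightarrow> 'a::metric_space \<Rightarrow> 'a set \<Rightarrow> bool" where
  "upper_box_covering_control d x A \<longleftrightarrow>
     (\<forall>\<^sub>F R in at_right 0. \<forall>\<eta>>0. \<exists>C>0. \<exists>\<epsilon>\<^sub>0>0. \<forall>\<epsilon>. 0 < \<epsilon> \<and> \<epsilon> < \<epsilon>\<^sub>0 \<longrightarrow>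
        real (covering_number \<epsilon> (A \<inter> ball x R)) \<le> C * (R / \<epsilon>) powr (d + \<eta>))"

end

theory Submission
  imports Defs "HOL-Real_Asymp.Real_Asymp"
begin

text \<open>
  The covering control bounds the upper box dimension of all small pieces \<open>A \<inter> ball x R\<close> by
  \<open>d\<close>. Conversely, a set of diameter at most \<open>\<epsilon> / 2\<close> contains at most one point of an
  \<open>\<epsilon>\<close>-separated set, so ubiquity bounds the covering numbers of \<open>A \<inter> ball x r\<close> from below
  along the scales \<open>\<epsilon>\<^sub>m / 2\<close>; the constant factors disappear in the logarithmic quotient.
\<close>

text \<open>A \<open>LEAST\<close> is meaningful only if some number qualifies. Here one does: the
  closure of \<open>E\<close> is compact, hence totally bounded, so finitely many balls of radius
  \<open>\<epsilon> / 2\<close> cover it, and the minimum is attained by an actual cover.\<close>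

lemma covering_number_witness:
  fixes E :: "'a::heine_borel set"
  assumes "bounded E" "\<epsilon> > 0"
  obtains \<U> where "finite \<U>" "card \<U> = covering_number \<epsilon> E"
    "\<forall>U\<in>\<U>. bounded U \<and> diameter U \<le> \<epsilon>" "E \<subseteq> \<Union>\<U>"
proof -
  let ?P = "\<lambda>k. \<exists>\<U>. finite \<U> \<and> card \<U> = k \<and>
        (\<forall>U\<in>\<U>. bounded U \<and> diameter U \<le> \<epsilon>) \<and> E \<subseteq> \<Union>\<U>"
  have "compact (closure E)"
    using assms(1) by simp
  then obtain K where K: "finite K" "closure E \<subseteq> (\<Union>y\<in>K. ball y (\<epsilon> / 2))"
    using assms(2) unfolding compact_eq_totally_bounded by (meson half_gt_zero)
  have "diameter (ball y (\<epsilon> / 2)) \<le> \<epsilon>" for y :: 'a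
  proof -
    have "dist u v \<le> \<epsilon>" if "u \<in> ball y (\<epsilon> / 2)" "v \<in> ball y (\<epsilon> / 2)" for u v
      using that dist_triangle_half_r[of y u \<epsilon> v] by simp
    then show ?thesis
      using assms(2) unfolding diameter_def by (auto intro!: cSUP_least)
  qed
  then have "?P (card ((\<lambda>y. ball y (\<epsilon> / 2)) ` K))"
    using K closure_subset[of E]
    by (intro exI[of _ "(\<lambda>y. ball y (\<epsilon> / 2)) ` K"]) auto
  then have "?P (covering_number \<epsilon> E)"
    unfolding covering_number_def by (rule LeastI)
  then show thesis
    using that by blast
qed

text \<open>The empty family cannot cover a nonempty set. Positivity is what permits taking
  logarithms of covering numbers monotonically.\<close>

lemma covering_number_pos:
  fixes E :: "'a::heine_borel set"
  assumes "bounded E" "\<epsilon> > 0" "E \<noteq> {}"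
  shows "covering_number \<epsilon> E > 0"
proof -
  obtain \<U> where "finite \<U>" "card \<U> = covering_number \<epsilon> E" "E \<subseteq> \<Union>\<U>"
    by (rule covering_number_witness[OF assms(1,2)])
  then show ?thesis
    using assms(3) by (metis Union_empty card_gt_0_iff subset_empty)
qed

text \<open>Sending each point of \<open>F\<close> to a member of an optimal cover containing it is
  injective. The inequality \<open>\<delta> < \<epsilon>\<close> must be strict, since separated
  points may lie at distance exactly \<open>\<epsilon>\<close>.\<close>

lemma card_separated_le_covering_number:
  fixes E :: "'a::heine_borel set"
  assumes "bounded E" "0 < \<delta>" "\<delta> < \<epsilon>" "F \<subseteq> E" "separated_by \<epsilon> F"
  shows "card F \<le> covering_number \<delta> E"
proof -
  obtain \<U> where U: "finite \<U>" "card \<U> = covering_number \<delta> E"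
    "\<forall>U\<in>\<U>. bounded U \<and> diameter U \<le> \<delta>" "E \<subseteq> \<Union>\<U>"
    by (rule covering_number_witness[OF assms(1,2)])
  have "\<forall>y\<in>F. \<exists>U\<in>\<U>. y \<in> U"
    using U(4) assms(4) by blast
  then obtain g where g: "\<And>y. y \<in> F \<Longrightarrow> g y \<in> \<U> \<and> y \<in> g y"
    by metis
  have "inj_on g F"
  proof (rule inj_onI, rule ccontr)
    fix a b assume ab: "a \<in> F" "b \<in> F" "g a = g b" "a \<noteq> b"
    \<comment> \<open>Boundedness of the covering set enters here: without it
      \<open>diameter\<close> need not dominate distances.\<close>
    then have "dist a b \<le> diameter (g a)"
      using g U(3) by (metis diameter_bounded_bound)
    also have "\<dots> \<le> \<delta>"
      using g U(3) ab by blast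
    finally show False
      using ab assms(3,5) unfolding separated_by_def by fastforce
  qed
  then show ?thesis
    using U(1,2) g by (metis card_inj_on_le image_subsetI)
qed

text \<open>After taking logarithms, \<open>C\<close> and \<open>R\<close> only add a constant to
  the numerator, which vanishes on division by \<open>ln (1 / \<epsilon>)\<close>, a quantity
  tending to infinity.\<close>

lemma upper_box_dim_le:
  fixes E :: "'a::heine_borel set"
  assumes "bounded E" "E \<noteq> {}" "R > 0" "C > 0" "\<epsilon>\<^sub>0 > 0"
    and bound: "\<And>\<epsilon>. 0 < \<epsilon> \<Longrightarrow> \<epsilon> < \<epsilon>\<^sub>0 \<Longrightarrow> real (covering_number \<epsilon> E) \<le> C * (R / \<epsilon>) powr s"
  shows "upper_box_dim E \<le> ereal s"
proof -
  define h where "h = (\<lambda>\<epsilon>::real. (ln C + s * ln (R / \<epsilon>)) / ln (1 / \<epsilon>))"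
  have "\<forall>\<^sub>F \<epsilon> in at_right 0. ereal (ln (real (covering_number \<epsilon> E)) / ln (1 / \<epsilon>)) \<le> ereal (h \<epsilon>)"
    unfolding eventually_at_right_field
  \<comment> \<open>Below 1 the denominator \<open>ln (1 / \<epsilon>)\<close> is positive, so
    dividing keeps the inequality; below \<open>\<epsilon>\<^sub>0\<close> the assumed bound
    applies.\<close>
  proof (intro exI[of _ "min 1 \<epsilon>\<^sub>0"] conjI allI impI)
    fix \<epsilon> :: real assume e: "0 < \<epsilon>" "\<epsilon> < min 1 \<epsilon>\<^sub>0"
    have "ln (real (covering_number \<epsilon> E)) \<le> ln (C * (R / \<epsilon>) powr s)"
      using bound[of \<epsilon>] covering_number_pos[OF assms(1) _ assms(2), of \<epsilon>] e by simp
    also have "\<dots> = ln C + s * ln (R / \<epsilon>)"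
      using e assms by (simp add: ln_mult ln_powr)
    finally show "ereal (ln (real (covering_number \<epsilon> E)) / ln (1 / \<epsilon>)) \<le> ereal (h \<epsilon>)"
      using e by (simp add: h_def divide_right_mono)
  qed (use assms in auto)
  then have "upper_box_dim E \<le> Limsup (at_right 0) (\<lambda>\<epsilon>. ereal (h \<epsilon>))"
    unfolding upper_box_dim_def by (rule Limsup_mono)
  also have "(h \<longlongrightarrow> s) (at_right 0)"
    unfolding h_def using assms(3) by real_asymp
  then have "Limsup (at_right 0) (\<lambda>\<epsilon>. ereal (h \<epsilon>)) = ereal s"
    by (intro lim_imp_Limsup) auto
  finally show ?thesis .
qed

text \<open>An upper limit is bounded below by its value along any sequence of scales tending to 0
  from the right, so good packings along one such sequence suffice.\<close>

lemma upper_box_dim_ge: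
  fixes E :: "'a::heine_borel set" and \<epsilon> :: "nat \<Rightarrow> real" and F :: "nat \<Rightarrow> 'a set"
  assumes "bounded E" "\<rho> > 0" "\<epsilon> \<longlonglongrightarrow> 0" "\<And>m. 0 < \<epsilon> m"
    and F: "\<And>m. F m \<subseteq> E" "\<And>m. separated_by (\<epsilon> m) (F m)"
    and card: "\<forall>\<^sub>F m in sequentially. (\<rho> / \<epsilon> m) powr s \<le> real (card (F m))"
  shows "ereal s \<le> upper_box_dim E"
proof -
  \<comment> \<open>The logarithmic quotient of the packing bound, expressed through the halved
    scale: \<open>\<epsilon> m = 2 * \<delta> m\<close>.\<close>
  define h where "h = (\<lambda>\<delta>::real. s * ln (\<rho> / (2 * \<delta>)) / ln (1 / \<delta>))"
  define \<delta> where "\<delta> = (\<lambda>m. \<epsilon> m / 2)"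
  define f where "f = (\<lambda>\<epsilon>. ereal (ln (real (covering_number \<epsilon> E)) / ln (1 / \<epsilon>)))"
  have "\<delta> \<longlonglongrightarrow> 0"
    unfolding \<delta>_def using assms(3) by (auto intro: tendsto_eq_intros)
  moreover have pos: "\<delta> m > 0" for m
    using assms(4) by (simp add: \<delta>_def)
  ultimately have lim: "filterlim \<delta> (at_right 0) sequentially"
    by (simp add: filterlim_at less_imp_neq[symmetric])
  have "(h \<longlongrightarrow> s) (at_right 0)"
    unfolding h_def using assms(2) by real_asymp
  from filterlim_compose[OF this lim] have "ereal s = Limsup sequentially (\<lambda>m. ereal (h (\<delta> m)))"
    by (intro lim_imp_Limsup[symmetric]) auto
  also have "\<dots> \<le> Limsup sequentially (\<lambda>m. f (\<delta> m))"
  proof (rule Limsup_mono)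
    have "\<forall>\<^sub>F m in sequentially. \<delta> m < 1"
      using \<open>\<delta> \<longlonglongrightarrow> 0\<close> by (rule order_tendstoD) simp
    with card show "\<forall>\<^sub>F m in sequentially. ereal (h (\<delta> m)) \<le> f (\<delta> m)"
    proof eventually_elim
      case (elim m)
      have "(\<rho> / (2 * \<delta> m)) powr s \<le> real (card (F m))"
        using elim(1) by (simp add: \<delta>_def)
      also have "\<dots> \<le> real (covering_number (\<delta> m) E)"
        using card_separated_le_covering_number[OF assms(1) pos _ F] assms(4)
        by (simp add: \<delta>_def)
      finally have le: "(\<rho> / (2 * \<delta> m)) powr s \<le> real (covering_number (\<delta> m) E)" .
      \<comment> \<open>A positive left side forces the covering number to be positive too, so
        \<open>ln\<close> preserves \<open>le\<close>.\<close>
      have "0 < (\<rho> / (2 * \<delta> m)) powr s"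
        using pos[of m] assms(2) by simp
      then have "ln ((\<rho> / (2 * \<delta> m)) powr s) \<le> ln (real (covering_number (\<delta> m) E))"
        using le by (intro ln_mono) auto
      then have "s * ln (\<rho> / (2 * \<delta> m)) \<le> ln (real (covering_number (\<delta> m) E))"
        using pos[of m] assms(2) by (simp add: ln_powr)
      then show ?case
        unfolding h_def f_def using elim(2) pos[of m] by (simp add: divide_right_mono)
    qed
  qed
  \<comment> \<open>The right side is the infimum of the suprema of \<open>f\<close> over sets
    \<open>P\<close> that are eventual at 0 from the right. Each such \<open>P\<close> eventually
    contains \<open>\<delta> m\<close>, so each supremum bounds the sequence.\<close>
  also have "\<dots> \<le> Limsup (at_right 0) f"
    unfolding Limsup_def[of "at_right 0"]
  proof (rule INF_greatest)
    fix P assume "P \<in> {P. eventually P (at_right (0::real))}"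
    then have "\<forall>\<^sub>F m in sequentially. P (\<delta> m)"
      using lim by (simp add: filterlim_iff)
    then have "\<forall>\<^sub>F m in sequentially. f (\<delta> m) \<le> Sup (f ` Collect P)"
      by eventually_elim (auto intro: SUP_upper)
    then show "Limsup sequentially (\<lambda>m. f (\<delta> m)) \<le> Sup (f ` Collect P)"
      by (rule Limsup_bounded)
  qed
  finally show ?thesis
    by (simp add: upper_box_dim_def f_def)
qed

text \<open>An infimum over radii is at most its value at any one radius, so a single small
  \<open>R\<close> is enough; then \<open>\<eta>\<close> tends to 0.\<close>

lemma pointwise_box_dim_le:
  fixes A :: "'a::heine_borel set"
  assumes "x \<in> closure A" "upper_box_covering_control d x A"
  shows "pointwise_box_dim x A \<le> ereal d"
proof -
  obtain b where b: "b > 0" and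
    cov: "\<And>R. 0 < R \<Longrightarrow> R < b \<Longrightarrow> \<forall>\<eta>>0. \<exists>C>0. \<exists>\<epsilon>\<^sub>0>0. \<forall>\<epsilon>. 0 < \<epsilon> \<and> \<epsilon> < \<epsilon>\<^sub>0 \<longrightarrow>
        real (covering_number \<epsilon> (A \<inter> ball x R)) \<le> C * (R / \<epsilon>) powr (d + \<eta>)"
    using assms(2) unfolding upper_box_covering_control_def eventually_at_right_field by blast
  define R where "R = b / 2"
  have R: "0 < R" "R < b"
    using b by (auto simp: R_def)
  have ne: "A \<inter> ball x R \<noteq> {}"
    using assms(1) R(1) unfolding closure_approachable by (metis IntI dist_commute empty_iff mem_ball)
  have "pointwise_box_dim x A \<le> ereal d + ereal \<eta>" if \<eta>: "\<eta> > 0" for \<eta>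
  proof -
    obtain C \<epsilon>\<^sub>0 where "C > 0" "\<epsilon>\<^sub>0 > 0"
      "\<And>\<epsilon>. 0 < \<epsilon> \<Longrightarrow> \<epsilon> < \<epsilon>\<^sub>0 \<Longrightarrow>
        real (covering_number \<epsilon> (A \<inter> ball x R)) \<le> C * (R / \<epsilon>) powr (d + \<eta>)"
      using cov[OF R, rule_format, OF \<eta>] by blast
    then have "upper_box_dim (A \<inter> ball x R) \<le> ereal (d + \<eta>)"
      using ne R(1) by (intro upper_box_dim_le[of _ R C \<epsilon>\<^sub>0]) (auto intro: bounded_subset)
    moreover have "pointwise_box_dim x A \<le> upper_box_dim (A \<inter> ball x R)"
      unfolding pointwise_box_dim_def using R(1) by (intro INF_lower) simp
    ultimately show ?thesis
      by simp
  qed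
  then show ?thesis
    by (rule ereal_le_epsilon2)
qed

text \<open>Bounding an infimum from below requires every radius \<open>r\<close>, and ubiquity
  supplies packings inside each ball, with an arbitrarily small loss \<open>\<eta>\<close> in the
  exponent.\<close>

lemma pointwise_box_dim_ge:
  fixes A :: "'a::heine_borel set"
  assumes "lower_spatial_ubiquity d x A"
  shows "ereal d \<le> pointwise_box_dim x A"
  unfolding pointwise_box_dim_def
proof (rule INF_greatest)
  fix r :: real assume "r \<in> {0<..}"
  then have r: "0 < r" "r < 2 * r" "0 < 2 * r"
    by auto
  have "ereal d \<le> upper_box_dim (A \<inter> ball x r) + ereal \<eta>" if \<eta>: "\<eta> > 0" for \<eta>
  proof -
    have "\<exists>(\<epsilon> :: nat \<Rightarrow> real) (F :: nat \<Rightarrow> 'a set).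
          decseq \<epsilon> \<and> \<epsilon> \<longlonglongrightarrow> 0 \<and> (\<forall>m. 0 < \<epsilon> m \<and> \<epsilon> m < r) \<and>
          (\<forall>m. finite (F m) \<and> F m \<subseteq> A \<inter> ball x r \<and> separated_by (\<epsilon> m) (F m)) \<and>
          (\<forall>\<^sub>F m in sequentially. (r / \<epsilon> m) powr (d - \<eta>) \<le> real (card (F m)))"
      \<comment> \<open>The radius \<open>r\<close> plays \<open>\<rho>\<close>; the value
        \<open>2 * r\<close> for \<open>\<rho>\<^sub>0\<close> is just some number above it.\<close>
      using assms[unfolded lower_spatial_ubiquity_def, rule_format, of "2 * r" r \<eta>] r \<eta> by simp
    then obtain \<epsilon> F where *: "\<epsilon> \<longlonglongrightarrow> 0" "\<And>m. 0 < \<epsilon> m"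
      "\<And>m. F m \<subseteq> A \<inter> ball x r" "\<And>m. separated_by (\<epsilon> m) (F m)"
      "\<forall>\<^sub>F m in sequentially. (r / \<epsilon> m) powr (d - \<eta>) \<le> real (card (F m))"
      by blast
    have "bounded (A \<inter> ball x r)"
      by (auto intro: bounded_subset)
    then have "ereal (d - \<eta>) \<le> upper_box_dim (A \<inter> ball x r)"
      using r(1) * by (rule upper_box_dim_ge)
    then show ?thesis
      by (metis add_right_mono diff_add_cancel plus_ereal.simps(1))
  qed
  then show "ereal d \<le> upper_box_dim (A \<inter> ball x r)"
    by (rule ereal_le_epsilon2)
qed

theorem theorem5p18:
  fixes A :: "(real ^ 'n) set" and x :: "real ^ 'n" and d :: real
  assumes "x \<in> closure A"
    and "0 \<le> d" and "d \<le> real CARD('n)"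
    and "lower_spatial_ubiquity d x A"
    and "upper_box_covering_control d x A"
  shows "pointwise_box_dim x A = ereal d"
  using pointwise_box_dim_le[OF assms(1,5)] pointwise_box_dim_ge[OF assms(4)]
  by (rule antisym)

end
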